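(* Let $n \geq 1$, let $(\ell_d)_{d \in \{-1,0,1\}^n}$ be integers with $\ell_d \geq 2$ for all $d$, and let $\lambda^*_{[n+1]}$ be the number defined from $(\ell_d)$ as in the context. Let $S$ be a sequence of points in $\mathbb{R}^n$ of length $$|S| > \lambda^*_{[n+1]}.$$ Then $S$ contains a strictly monotonic subsequence of length $\ell_d+1$ in direction $d$ for some $d \in \{-1,0,1\}^n$. In particular, for a positive integer $\ell$, if $|S| > \ell^{2^{n+1}-1}$ then $S$ contains a strictly monotonic subsequence of length $\ell+1$ (in some direction).
   Context: Notation: $[n] = \{1,\ldots,n\}$. A sequence of points $(x^j)_{j=1}^{\ell}$ with $x^j \in \mathbb{R}^n$ is strictly monotonic in direction $d \in \{-1,0,1\}^n$ if for each $i \in [n]$ the $i$th coordinate sequence $(x^j_i)_{j=1}^{\ell}$ is strictly decreasing, constant, or strictly increasing according to whether $d_i = -1$, $0$ or $1$ respectively. It is strictly monotonic if it is strictly monotonic in some direction. (The direction $d = (0,\ldots,0)$ is allowed. The points of the sequence $S$ need not be distinct. A subsequence keeps the order of $S$.) For $k \geq 1$, $D_k = \{ d \in \{-1,0,1\}^k : d \neq (0,\ldots,0),\ d_{i_0} = 1 \text{ where } i_0 \text{ is the first position with } d_{i_0} \neq 0\}$. Given $(\ell_d)_{d \in \{-1,0,1\}^n}$, define $(\ell^*_d)_{d \in D_{n+1}}$, writing elements of $D_{n+1}$ as $(d_0,d_1,\ldots,d_n)$, by $\ell^*_{(d_0,d_1,\ldots,d_n)} = \ell_{(d_1,\ldots,d_n)}$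 if $d_0 = 1$, and $\ell^*_{(d_0,d_1,\ldots,d_n)} = 1$ otherwise (i.e. if $d_0=0$). For $d \in D_{n+1}$ let $N(d) \subset [n+1]$ be the set of positions of the nonzero coordinates of $d$ (with $d_0$ in position $1$, ..., $d_n$ in position $n+1$). For nonempty $I \subset [n+1]$ put $m^*_I = \prod_{d \in D_{n+1} : N(d) = I} \ell^*_d$, and define $\lambda^*_I$ for $I \subset [n+1]$ recursively by $\lambda^*_\emptyset = 1$ and $\lambda^*_I = m^*_I \cdot \max_{i \in I} \lambda^*_{I \setminus \{i\}}$ for $I \neq \emptyset$. *)

theory Defs
  imports Complex_Main "HOL-Library.FuncSet" "HOL-Library.Sublist"
begin

text \<open>
  The dimension is a natural number that varies (both \<open>n\<close> and \<open>n + 1\<close> occur), so vectors of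
  length \<open>k\<close> are extensional functions on \<open>{1..k}\<close>. Finite sequences of points are lists;
  subsequences are given by \<open>subseq\<close>, which keeps the order and treats repeated points as
  separate entries.
\<close>

definition points :: "nat \<Rightarrow> (nat \<Rightarrow> real) set" where
  "points n = {1..n} \<rightarrow>\<^sub>E UNIV"

definition directions :: "nat \<Rightarrow> (nat \<Rightarrow> int) set" where
  "directions k = {1..k} \<rightarrow>\<^sub>E {-1, 0, 1}"

definition strictly_monotonic_in :: "nat \<Rightarrow> (nat \<Rightarrow> int) \<Rightarrow> (nat \<Rightarrow> real) list \<Rightarrow> bool" where
  "strictly_monotonic_in n d xs \<longleftrightarrow>
     (\<forall>i\<in>{1..n}.
        (d i = -1 \<longrightarrow> sorted_wrt (>) (map (\<lambda>x. x i) xs)) \<and>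
        (d i = 0 \<longrightarrow> sorted_wrt (=) (map (\<lambda>x. x i) xs)) \<and>
        (d i = 1 \<longrightarrow> sorted_wrt (<) (map (\<lambda>x. x i) xs)))"

definition strictly_monotonic :: "nat \<Rightarrow> (nat \<Rightarrow> real) list \<Rightarrow> bool" where
  "strictly_monotonic n xs \<longleftrightarrow> (\<exists>d\<in>directions n. strictly_monotonic_in n d xs)"

definition nonzero_positions :: "nat \<Rightarrow> (nat \<Rightarrow> int) \<Rightarrow> nat set" where
  "nonzero_positions k d = {i \<in> {1..k}. d i \<noteq> 0}"

definition positive_directions :: "nat \<Rightarrow> (nat \<Rightarrow> int) set" where
  "positive_directions k =
     {d \<in> directions k. nonzero_positions k d \<noteq> {} \<and> d (Min (nonzero_positions k d)) = 1}"

text \<open>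
  A direction \<open>(d\<^sub>0, \<dots>, d\<^sub>n)\<close> of length \<open>n + 1\<close> is indexed by position: \<open>d\<^sub>0\<close> is \<open>d 1\<close> and
  \<open>d\<^sub>i\<close> is \<open>d (i + 1)\<close>.
\<close>

definition ell_star :: "nat \<Rightarrow> ((nat \<Rightarrow> int) \<Rightarrow> nat) \<Rightarrow> (nat \<Rightarrow> int) \<Rightarrow> nat" where
  "ell_star n l d = (if d 1 = 1 then l (\<lambda>i\<in>{1..n}. d (i + 1)) else 1)"

definition m_star :: "nat \<Rightarrow> ((nat \<Rightarrow> int) \<Rightarrow> nat) \<Rightarrow> nat set \<Rightarrow> nat" where
  "m_star n l I =
     (\<Prod>d\<in>{d \<in> positive_directions (n + 1). nonzero_positions (n + 1) d = I}. ell_star n l d)"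

text \<open>Only finite index sets matter; the value \<open>1\<close> at infinite sets is a dummy.\<close>

function lambda_star :: "nat \<Rightarrow> ((nat \<Rightarrow> int) \<Rightarrow> nat) \<Rightarrow> nat set \<Rightarrow> nat" where
  "lambda_star n l I =
     (if finite I \<and> I \<noteq> {} then m_star n l I * Max ((\<lambda>i. lambda_star n l (I - {i})) ` I) else 1)"
  by pat_completeness auto
termination
  by (relation "measure (\<lambda>(n, l, I). card I)") (auto simp: card_gt_0_iff)

declare lambda_star.simps [simp del]

end

theory Submission
  imports Defs
begin

text \<open>
  Write \<open>p a\<close> for the point with index \<open>a\<close> of the sequence. Two indices \<open>a < b\<close> determine exactly
  one direction, the vector of signs of \<open>p b - p a\<close>; its support is the set of coordinates in which
  the two points differ. Prepending the index as coordinate number \<open>1\<close> makes all points distinct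
  there, which is why only the values of \<open>lambda_star\<close> at index sets containing \<open>1\<close> matter. Such a set is
  \<open>insert 1 (Suc ` J)\<close> with \<open>J \<subseteq> {1..n}\<close>, and its factor \<open>m_star\<close> is the product \<open>M J\<close> of the \<open>l d\<close>
  over the directions \<open>d\<close> with support \<open>J\<close> (\<open>m_star_insert_Suc_image\<close>). Let \<open>\<Lambda> J\<close> be the value of
  \<open>lambda_star\<close> there.

  The heart is \<open>card_le_lambda_star\<close>: a family of points that agree outside \<open>J\<close> and have no monotone
  subsequence that is too long has at most \<open>\<Lambda> J\<close> members. It goes by induction on \<open>card J\<close>.
  A step in a fixed direction is a transitive relation, so the family splits into \<open>l d\<close> layers without
  a step in direction \<open>d\<close> (\<open>ex_layering\<close>). Doing this for all \<open>d\<close> with support \<open>J\<close> costs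
  a factor \<open>M J\<close> and leaves families \<open>Z\<close> in which no two points differ in all of \<open>J\<close>
  (\<open>card_le_by_layers\<close>). It remains to bound \<open>Z\<close> by the maximum of \<open>\<Lambda> (J - {i})\<close> over \<open>i \<in> J\<close>.

  If all points of \<open>Z\<close> agree in some coordinate \<open>i \<in> J\<close>, this is the induction hypothesis.
  Otherwise \<open>Z\<close> is small for a crude reason: it is covered by \<open>card J * (card J - 1)\<close> subfamilies, each
  constant in two coordinates \<open>i\<close> and \<open>j\<close> of \<open>J\<close> (\<open>intersecting_family_cover\<close>) and so of size at most
  \<open>\<Lambda> (J - {i, j})\<close>. Since \<open>\<Lambda> (J - {i})\<close> is at least this times \<open>M (J - {i})\<close>, a product of
  \<open>2 ^ (card J - 1)\<close> numbers that are at least \<open>2\<close>, there is ample room. This is where \<open>l d \<ge> 2\<close> enters.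

  For a constant \<open>l\<close>, at most \<open>2 ^ (card I - 1)\<close> directions contribute to \<open>m_star\<close> at \<open>I\<close>, and these
  exponents add up to \<open>2 ^ (n + 1) - 1\<close> along a chain of index sets. The value \<open>l = 1\<close> is treated
  separately: any two points in a row are strictly monotonic in the direction of their difference.
\<close>

section \<open>Directions and their supports\<close>

definition supported_directions :: "nat \<Rightarrow> nat set \<Rightarrow> (nat \<Rightarrow> int) set" where
  "supported_directions n J = {d \<in> directions n. nonzero_positions n d = J}"

text \<open>
  For a direction \<open>d\<close> the three cases of strict monotonicity become one equation of signs, so that a
  monotonic sequence is a chain of the relation \<open>step_in n d\<close>.
\<close>

definition step_in :: "nat \<Rightarrow> (nat \<Rightarrow> int) \<Rightarrow> (nat \<Rightarrow> real) \<Rightarrow> (nat \<Rightarrow> real) \<Rightarrow> bool" where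
  "step_in n d p q \<longleftrightarrow> (\<forall>i\<in>{1..n}. sgn (q i - p i) = of_int (d i))"

lemma finite_directions [simp]: "finite (directions n)"
  by (simp add: directions_def finite_PiE)

lemma finite_supported_directions [simp]: "finite (supported_directions n J)"
  by (simp add: supported_directions_def)

lemma finite_positive_directions [simp]: "finite (positive_directions k)"
  by (simp add: positive_directions_def)

lemma supported_directions_eq_PiE:
  assumes "J \<subseteq> {1..n}"
  shows "supported_directions n J = (\<Pi>\<^sub>E i\<in>{1..n}. if i \<in> J then {-1, 1} else {0})"
proof (rule set_eqI)
  fix d :: "nat \<Rightarrow> int"
  have "{i \<in> {1..n}. d i \<noteq> 0} = J \<longleftrightarrow> (\<forall>i\<in>{1..n}. d i \<noteq> 0 \<longleftrightarrow> i \<in> J)"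
    using assms by blast
  moreover have "d i \<in> {-1, 0, 1} \<and> (d i \<noteq> 0 \<longleftrightarrow> i \<in> J) \<longleftrightarrow> d i \<in> (if i \<in> J then {-1, 1} else {0})" for i
    by auto
  ultimately have "(\<forall>i\<in>{1..n}. d i \<in> {-1, 0, 1}) \<and> {i \<in> {1..n}. d i \<noteq> 0} = J \<longleftrightarrow>
      (\<forall>i\<in>{1..n}. d i \<in> (if i \<in> J then {-1, 1} else {0}))"
    by (simp only: flip: ball_conj_distrib)
  then show "d \<in> supported_directions n J \<longleftrightarrow> d \<in> (\<Pi>\<^sub>E i\<in>{1..n}. if i \<in> J then {-1, 1} else {0})"
    unfolding supported_directions_def directions_def nonzero_positions_def PiE_iff mem_Collect_eq
    by (simp only: conj_commute conj_left_commute)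
qed

lemma card_supported_directions:
  assumes "J \<subseteq> {1..n}"
  shows "card (supported_directions n J) = 2 ^ card J"
proof -
  have "card (supported_directions n J) = (\<Prod>i\<in>{1..n}. if i \<in> J then 2 else 1)"
    unfolding supported_directions_eq_PiE[OF assms]
    by (auto simp: card_PiE intro!: prod.cong)
  also have "\<dots> = (\<Prod>i\<in>{1..n} \<inter> J. 2)"
    by (simp add: prod.If_cases Int_def)
  also have "\<dots> = 2 ^ card J"
    using assms by (simp add: Int_absorb1)
  finally show ?thesis .
qed

text \<open>
  The sign at the first nonzero position is forced, so only the other \<open>card I - 1\<close> signs are free.
\<close>

lemma card_positive_directions_le:
  "card {d \<in> positive_directions k. nonzero_positions k d = I} \<le> 2 ^ (card I - 1)"
proof (cases "I \<noteq> {} \<and> I \<subseteq> {1..k}")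
  case True
  then have fin: "finite I" and Min: "Min I \<in> I" "Min I \<in> {1..k}"
  proof -
    show "finite I"
      using True finite_subset by blast
    then show "Min I \<in> I"
      using True by simp
    then show "Min I \<in> {1..k}"
      using True by blast
  qed
  let ?P = "{d \<in> positive_directions k. nonzero_positions k d = I}"
  have "card ?P \<le> card (supported_directions k (I - {Min I}))"
  proof (rule card_inj_on_le)
    show "inj_on (\<lambda>d. d(Min I := 0)) ?P"
    proof (rule inj_onI)
      fix d e assume "d \<in> ?P" "e \<in> ?P" and eq: "d(Min I := 0) = e(Min I := 0)"
      then have "d (Min I) = e (Min I)"
        by (auto simp: positive_directions_def)
      then have "d i = e i" for i
        using fun_cong[OF eq, of i] by (cases "i = Min I") auto
      then show "d = e" ..
    qed
    show "(\<lambda>d. d(Min I := 0)) ` ?P \<subseteq> supported_directions k (I - {Min I})"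
      using Min(2) by (auto simp: supported_directions_def positive_directions_def directions_def
          nonzero_positions_def PiE_iff extensional_def split: if_splits)
  qed simp
  also have "\<dots> = 2 ^ (card I - 1)"
    using True fin Min by (subst card_supported_directions) auto
  finally show ?thesis .
next
  case False
  then have "{d \<in> positive_directions k. nonzero_positions k d = I} = {}"
    by (auto simp: positive_directions_def nonzero_positions_def)
  then show ?thesis
    by (metis card.empty zero_le)
qed

lemma strictly_monotonic_in_iff:
  assumes "d \<in> directions n"
  shows "strictly_monotonic_in n d xs \<longleftrightarrow> sorted_wrt (step_in n d) xs"
proof -
  have d: "d i = -1 \<or> d i = 0 \<or> d i = 1" if "i \<in> {1..n}" for i
    using assms that by (auto simp: directions_def PiE_iff)
  have "strictly_monotonic_in n d xs \<longleftrightarrow>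
      (\<forall>i\<in>{1..n}. sorted_wrt (\<lambda>p q. sgn (q i - p i) = of_int (d i)) xs)"
    unfolding strictly_monotonic_in_def
  proof (rule ball_cong[OF refl])
    fix i assume i: "i \<in> {1..n}"
    have "sgn (q i - p i) = 1 \<longleftrightarrow> p i < q i" "sgn (q i - p i) = -1 \<longleftrightarrow> p i > q i"
      "sgn (q i - p i) = 0 \<longleftrightarrow> p i = q i" for p q :: "nat \<Rightarrow> real"
      by (auto simp: sgn_if)
    then have sgn_iff: "sorted_wrt (\<lambda>p q. sgn (q i - p i) = 1) xs \<longleftrightarrow> sorted_wrt (\<lambda>p q. p i < q i) xs"
      "sorted_wrt (\<lambda>p q. sgn (q i - p i) = -1) xs \<longleftrightarrow> sorted_wrt (\<lambda>p q. p i > q i) xs"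
      "sorted_wrt (\<lambda>p q. sgn (q i - p i) = 0) xs \<longleftrightarrow> sorted_wrt (\<lambda>p q. p i = q i) xs"
      by (simp_all only:)
    from d[OF i] show "((d i = -1 \<longrightarrow> sorted_wrt (>) (map (\<lambda>x. x i) xs)) \<and>
        (d i = 0 \<longrightarrow> sorted_wrt (=) (map (\<lambda>x. x i) xs)) \<and>
        (d i = 1 \<longrightarrow> sorted_wrt (<) (map (\<lambda>x. x i) xs))) \<longleftrightarrow>
        sorted_wrt (\<lambda>p q. sgn (q i - p i) = of_int (d i)) xs"
      by (elim disjE) (simp_all add: sorted_wrt_map sgn_iff del: sgn_0_0)
  qed
  also have "\<dots> \<longleftrightarrow> sorted_wrt (step_in n d) xs"
    by (auto simp: sorted_wrt_iff_nth_less step_in_def)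
  finally show ?thesis .
qed

lemma step_in_trans:
  assumes "d \<in> directions n" "step_in n d p q" "step_in n d q r"
  shows "step_in n d p r"
  unfolding step_in_def
proof
  fix i assume i: "i \<in> {1..n}"
  then have "d i = -1 \<or> d i = 0 \<or> d i = 1"
    using assms(1) by (auto simp: directions_def PiE_iff)
  moreover have "sgn (q i - p i) = of_int (d i)" "sgn (r i - q i) = of_int (d i)"
    using assms i by (auto simp: step_in_def)
  ultimately show "sgn (r i - p i) = of_int (d i)"
    by (auto simp: sgn_1_pos sgn_1_neg sgn_0_0)
qed

lemma ex_step_in:
  obtains d where "d \<in> supported_directions n {i \<in> {1..n}. p i \<noteq> q i}" "step_in n d p q"
proof
  let ?d = "\<lambda>i\<in>{1..n}. if q i < p i then -1 else if q i = p i then 0 else 1 :: int"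
  show "?d \<in> supported_directions n {i \<in> {1..n}. p i \<noteq> q i}"
    by (auto simp: supported_directions_def directions_def nonzero_positions_def)
  show "step_in n ?d p q"
    by (auto simp: step_in_def)
qed

section \<open>The numbers lambda\<close>

text \<open>
  A direction whose support contains position \<open>1\<close> is positive exactly if its first entry is \<open>1\<close>,
  and the remaining entries then form an arbitrary direction of length \<open>n\<close>.
\<close>

lemma m_star_insert_Suc_image:
  assumes "J \<subseteq> {1..n}"
  shows "m_star n l (insert 1 (Suc ` J)) = (\<Prod>d\<in>supported_directions n J. l d)"
proof -
  let ?P = "{d \<in> positive_directions (n + 1). nonzero_positions (n + 1) d = insert 1 (Suc ` J)}"
  let ?tail = "\<lambda>d. \<lambda>i\<in>{1..n}. d (i + 1) :: int"
  let ?cons = "\<lambda>d. \<lambda>i\<in>{1..n+1}. if i = 1 then 1 else d (i - 1) :: int"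
  have head: "d 1 = 1" if "d \<in> ?P" for d
  proof -
    have "finite (Suc ` J)"
      using assms finite_subset by blast
    then have "Min (insert 1 (Suc ` J)) = 1"
      by (intro Min_eqI) auto
    with that show ?thesis by (auto simp: positive_directions_def)
  qed
  show ?thesis
    unfolding m_star_def
  proof (rule prod.reindex_bij_witness[where i = ?cons and j = ?tail])
    fix d assume d: "d \<in> ?P"
    then have dd: "d \<in> directions (n + 1)" and N: "nonzero_positions (n + 1) d = insert 1 (Suc ` J)"
      by (auto simp: positive_directions_def)
    show "?cons (?tail d) = d"
    proof
      fix i show "?cons (?tail d) i = d i"
        using dd head[OF d]
        by (cases i) (auto simp: directions_def PiE_iff extensional_def)
    qed
    have "d (i + 1) \<noteq> 0 \<longleftrightarrow> i \<in> J" if "i \<in> {1..n}" for i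
    proof -
      have "d (i + 1) \<noteq> 0 \<longleftrightarrow> i + 1 \<in> nonzero_positions (n + 1) d"
        using that by (auto simp: nonzero_positions_def)
      also have "\<dots> \<longleftrightarrow> i \<in> J"
        using that unfolding N by auto
      finally show ?thesis .
    qed
    then have "nonzero_positions n (?tail d) = J"
      using assms by (auto simp: nonzero_positions_def)
    moreover have "?tail d \<in> directions n"
      using dd by (auto simp: directions_def PiE_iff)
    ultimately show "?tail d \<in> supported_directions n J"
      by (simp add: supported_directions_def)
    show "l (?tail d) = ell_star n l d"
      using head[OF d] by (simp add: ell_star_def)
  next
    fix d assume "d \<in> supported_directions n J"
    then have d: "d \<in> directions n" and J: "J = {i \<in> {1..n}. d i \<noteq> 0}"
      by (auto simp: supported_directions_def nonzero_positions_def)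
    show "?tail (?cons d) = d"
      using d by (auto simp: directions_def PiE_iff extensional_def)
    have N: "nonzero_positions (n + 1) (?cons d) = insert 1 (Suc ` J)"
    proof (rule set_eqI)
      fix i show "i \<in> nonzero_positions (n + 1) (?cons d) \<longleftrightarrow> i \<in> insert 1 (Suc ` J)"
        by (cases i) (auto simp: J nonzero_positions_def)
    qed
    have "Min (insert 1 (Suc ` J)) = 1"
      using J by (intro Min_eqI) auto
    with N have "?cons d (Min (nonzero_positions (n + 1) (?cons d))) = 1"
      by simp
    moreover have "?cons d i \<in> {-1, 0, 1}" if "i \<in> {1..n + 1}" for i
    proof (cases "i = 1")
      case False
      with that have "i - 1 \<in> {1..n}" by auto
      then have "d (i - 1) \<in> {-1, 0, 1}"
        using d by (auto simp: directions_def PiE_iff)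
      with False that show ?thesis by simp
    qed simp
    then have "?cons d \<in> directions (n + 1)"
      unfolding directions_def by (intro PiE_I) auto
    ultimately show "?cons d \<in> ?P"
      using N by (auto simp: positive_directions_def)
  qed
qed

lemma m_star_mult_lambda_star_le:
  assumes "finite I" "i \<in> I"
  shows "m_star n l I * lambda_star n l (I - {i}) \<le> lambda_star n l I"
proof -
  have "lambda_star n l (I - {i}) \<le> Max ((\<lambda>i. lambda_star n l (I - {i})) ` I)"
    using assms by (intro Max_ge) auto
  then show ?thesis
    using assms by (subst (2) lambda_star.simps) auto
qed

text \<open>
  Passing from \<open>c\<close> to \<open>c + 1\<close> positions adds at most \<open>2 ^ c\<close> factors \<open>l\<close>, and
  \<open>1 + 2 + \<dots> + 2 ^ c = 2 ^ (c + 1) - 1\<close>.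
\<close>

lemma lambda_star_const_le:
  assumes "l \<ge> 1" "finite I"
  shows "lambda_star n (\<lambda>_. l) I \<le> l ^ (2 ^ card I - 1)"
  using assms(2)
proof (induction "card I" arbitrary: I)
  case 0
  then show ?case by (simp add: lambda_star.simps)
next
  case (Suc c)
  have card_I: "card I = Suc c"
    using Suc.hyps(2) by simp
  then have "I \<noteq> {}" by auto
  have "m_star n (\<lambda>_. l) I \<le> l ^ 2 ^ c"
    unfolding m_star_def using assms(1) card_positive_directions_le[of "n + 1" I]
    by (intro prod_le_power) (auto simp: ell_star_def card_I)
  moreover have "Max ((\<lambda>i. lambda_star n (\<lambda>_. l) (I - {i})) ` I) \<le> l ^ (2 ^ c - 1)"
  proof -
    have "lambda_star n (\<lambda>_. l) (I - {i}) \<le> l ^ (2 ^ c - 1)" if "i \<in> I" for i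
    proof -
      have "c = card (I - {i})"
        using that card_I Suc.prems by (simp add: card_Diff_singleton)
      then show ?thesis
        using Suc.hyps(1)[of "I - {i}"] Suc.prems by simp
    qed
    then show ?thesis
      using \<open>I \<noteq> {}\<close> Suc.prems by simp
  qed
  ultimately have "m_star n (\<lambda>_. l) I * Max ((\<lambda>i. lambda_star n (\<lambda>_. l) (I - {i})) ` I)
      \<le> l ^ 2 ^ c * l ^ (2 ^ c - 1)"
    by (rule mult_le_mono)
  then have "lambda_star n (\<lambda>_. l) I \<le> l ^ 2 ^ c * l ^ (2 ^ c - 1)"
    using \<open>I \<noteq> {}\<close> Suc.prems by (subst lambda_star.simps) simp
  also have "\<dots> = l ^ (2 ^ card I - 1)"
  proof -
    have "2 ^ c + (2 ^ c - 1) = (2 ^ card I - 1 :: nat)"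
      by (simp add: card_I)
    then show ?thesis
      by (metis power_add)
  qed
  finally show ?case .
qed

section \<open>Layers of a transitive relation\<close>

text \<open>
  This is Mirsky's theorem for the order ``\<open>a < b\<close> and \<open>R (p a) (p b)\<close>''. The minimal elements form
  the bottom layer; removing them shortens every chain, because the least element of a chain of
  non-minimal elements can be preceded by one more element.
\<close>

lemma ex_layering:
  fixes X :: "'a::linorder set"
  assumes "finite X"
    and trans: "\<And>p q r. R p q \<Longrightarrow> R q r \<Longrightarrow> R p r"
    and "\<And>Y. Y \<subseteq> X \<Longrightarrow> monotone_on Y (<) R p \<Longrightarrow> card Y \<le> L"
  shows "\<exists>h :: 'a \<Rightarrow> nat. h ` X \<subseteq> {..<L} \<and> (\<forall>a\<in>X. \<forall>b\<in>X. a < b \<longrightarrow> R (p a) (p b) \<longrightarrow> h a < h b)"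
  using assms(1,3)
proof (induction L arbitrary: X)
  case 0
  have "X = {}"
  proof (rule ccontr)
    assume "X \<noteq> {}"
    then obtain x where "x \<in> X" by blast
    moreover have "monotone_on {x} (<) R p"
      by (simp add: monotone_on_def)
    ultimately show False
      using "0.prems"(2)[of "{x}"] by simp
  qed
  then show ?case by simp
next
  case (Suc L)
  define X' where "X' = {b \<in> X. \<exists>a\<in>X. a < b \<and> R (p a) (p b)}"
  have "X' \<subseteq> X" by (auto simp: X'_def)
  have "card Y \<le> L" if Y: "Y \<subseteq> X'" "monotone_on Y (<) R p" for Y
  proof (cases "Y = {}")
    case False
    have fin: "finite Y"
      using Y(1) \<open>X' \<subseteq> X\<close> Suc.prems(1) by (meson finite_subset)
    then have "Min Y \<in> X'"
      using False Y(1) Min_in by blast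
    then obtain a where a: "a \<in> X" "a < Min Y" "R (p a) (p (Min Y))"
      by (auto simp: X'_def)
    have less: "a < y" if "y \<in> Y" for y
      using a(2) fin that by (meson Min_le less_le_trans)
    have "R (p a) (p y)" if "y \<in> Y" for y
    proof (cases "y = Min Y")
      case False
      then have "Min Y < y"
        using fin that by (simp add: order.strict_iff_order)
      then have "R (p (Min Y)) (p y)"
        using monotone_onD[OF Y(2)] that fin False \<open>Y \<noteq> {}\<close> by simp
      with a(3) show ?thesis by (rule trans)
    qed (use a in simp)
    then have "monotone_on (insert a Y) (<) R p"
      using less monotone_onD[OF Y(2)]
      by (intro monotone_onI) (metis insert_iff less_asym less_irrefl)
    moreover have "insert a Y \<subseteq> X"
      using a(1) Y(1) \<open>X' \<subseteq> X\<close> by auto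
    ultimately have "card (insert a Y) \<le> Suc L"
      using Suc.prems(2)[of "insert a Y"] by simp
    moreover have "a \<notin> Y"
      using less by blast
    ultimately show ?thesis
      using fin by simp
  qed simp
  then obtain h where h: "h ` X' \<subseteq> {..<L}"
    "\<And>a b. a \<in> X' \<Longrightarrow> b \<in> X' \<Longrightarrow> a < b \<Longrightarrow> R (p a) (p b) \<Longrightarrow> h a < h b"
    using Suc.IH[of X'] Suc.prems(1) \<open>X' \<subseteq> X\<close> by (metis finite_subset)
  show ?case
  proof (intro exI[of _ "\<lambda>a. if a \<in> X' then Suc (h a) else 0"] conjI ballI impI)
    show "(\<lambda>a. if a \<in> X' then Suc (h a) else 0) ` X \<subseteq> {..<Suc L}"
      using h(1) by auto
    fix a b assume "a \<in> X" "b \<in> X" "a < b" "R (p a) (p b)"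
    then show "(if a \<in> X' then Suc (h a) else 0) < (if b \<in> X' then Suc (h b) else 0)"
      using h(2)[of a b] by (auto simp: X'_def)
  qed
qed

text \<open>
  Two indices with the same layer for every \<open>d \<in> D\<close> are unrelated by all the relations \<open>R d\<close>, and there
  are only \<open>\<Prod>d\<in>D. l d\<close> combinations of layers.
\<close>

lemma card_le_by_layers:
  fixes X :: "'a::linorder set" and R :: "'d \<Rightarrow> 'b \<Rightarrow> 'b \<Rightarrow> bool"
  assumes "finite X" "finite D"
    and trans: "\<And>d p q r. d \<in> D \<Longrightarrow> R d p q \<Longrightarrow> R d q r \<Longrightarrow> R d p r"
    and chains: "\<And>d Y. d \<in> D \<Longrightarrow> Y \<subseteq> X \<Longrightarrow> monotone_on Y (<) (R d) p \<Longrightarrow> card Y \<le> l d"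
    and antichains: "\<And>Z. Z \<subseteq> X \<Longrightarrow>
      (\<And>d a b. d \<in> D \<Longrightarrow> a \<in> Z \<Longrightarrow> b \<in> Z \<Longrightarrow> a < b \<Longrightarrow> \<not> R d (p a) (p b)) \<Longrightarrow> card Z \<le> B"
  shows "card X \<le> (\<Prod>d\<in>D. l d) * B"
proof -
  have "\<forall>d\<in>D. \<exists>h :: 'a \<Rightarrow> nat. h ` X \<subseteq> {..<l d} \<and>
      (\<forall>a\<in>X. \<forall>b\<in>X. a < b \<longrightarrow> R d (p a) (p b) \<longrightarrow> h a < h b)"
  proof
    fix d assume "d \<in> D"
    then show "\<exists>h :: 'a \<Rightarrow> nat. h ` X \<subseteq> {..<l d} \<and>
        (\<forall>a\<in>X. \<forall>b\<in>X. a < b \<longrightarrow> R d (p a) (p b) \<longrightarrow> h a < h b)"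
      by (intro ex_layering assms(1)) (fact trans, fact chains)
  qed
  then obtain h :: "'d \<Rightarrow> 'a \<Rightarrow> nat" where
    h: "\<And>d. d \<in> D \<Longrightarrow> h d ` X \<subseteq> {..<l d}"
      "\<And>d a b. d \<in> D \<Longrightarrow> a \<in> X \<Longrightarrow> b \<in> X \<Longrightarrow> a < b \<Longrightarrow> R d (p a) (p b) \<Longrightarrow> h d a < h d b"
    by metis
  define label where "label a = (\<lambda>d\<in>D. h d a)" for a
  let ?labels = "\<Pi>\<^sub>E d\<in>D. {..<l d}"
  have "X \<subseteq> (\<Union>c\<in>?labels. {a \<in> X. label a = c})"
    using h(1) by (fastforce simp: label_def)
  then have "card X \<le> card (\<Union>c\<in>?labels. {a \<in> X. label a = c})"
    using assms(1,2) by (intro card_mono) (auto intro: finite_PiE)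
  also have "\<dots> \<le> (\<Sum>c\<in>?labels. card {a \<in> X. label a = c})"
    using assms(2) by (intro card_UN_le finite_PiE) auto
  also have "\<dots> \<le> (\<Sum>c\<in>?labels. B)"
  proof (intro sum_mono antichains)
    fix c d a b assume "d \<in> D" "a \<in> {a \<in> X. label a = c}" "b \<in> {a \<in> X. label a = c}" "a < b"
    then have "label a d = label b d" by simp
    with \<open>d \<in> D\<close> have "h d a = h d b" by (simp add: label_def)
    then show "\<not> R d (p a) (p b)"
      using h(2) \<open>d \<in> D\<close> \<open>a \<in> _\<close> \<open>b \<in> _\<close> \<open>a < b\<close> by (metis (mono_tags, lifting) less_irrefl mem_Collect_eq)
  qed auto
  also have "\<dots> = (\<Prod>d\<in>D. l d) * B"
    using assms(2) by (simp add: card_PiE)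
  finally show ?thesis .
qed

section \<open>Families that agree pairwise in some coordinate\<close>

text \<open>
  Choose \<open>z i\<close> differing from \<open>x\<close> in coordinate \<open>i\<close>. Any \<open>y\<close> agrees with \<open>x\<close> in some \<open>i\<close>, and with
  \<open>z i\<close> in some \<open>j\<close>; here \<open>j \<noteq> i\<close>, as otherwise \<open>x\<close> and \<open>z i\<close> would agree in \<open>i\<close>. Thus two
  coordinates of \<open>y\<close> are prescribed by \<open>(i, j)\<close>.
\<close>

lemma intersecting_family_cover:
  assumes "\<And>a b. a \<in> X \<Longrightarrow> b \<in> X \<Longrightarrow> \<exists>i\<in>J. p a i = p b i"
    and "\<And>i. i \<in> J \<Longrightarrow> \<exists>a\<in>X. \<exists>b\<in>X. p a i \<noteq> p b i"
    and "x \<in> X"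
  shows "\<exists>z. X = (\<Union>(i, j)\<in>(SIGMA i:J. J - {i}). {y \<in> X. p y i = p x i \<and> p y j = p (z i) j})"
proof -
  have "\<exists>z\<in>X. p z i \<noteq> p x i" if "i \<in> J" for i
    using assms(2)[OF that] by metis
  then obtain z where z: "\<And>i. i \<in> J \<Longrightarrow> z i \<in> X" "\<And>i. i \<in> J \<Longrightarrow> p (z i) i \<noteq> p x i"
    by metis
  have "X \<subseteq> (\<Union>(i, j)\<in>(SIGMA i:J. J - {i}). {y \<in> X. p y i = p x i \<and> p y j = p (z i) j})"
  proof
    fix y assume y: "y \<in> X"
    obtain i where i: "i \<in> J" "p y i = p x i"
      using assms(1)[OF y assms(3)] by blast
    obtain j where j: "j \<in> J" "p y j = p (z i) j"
      using assms(1)[OF y z(1)[OF i(1)]] by blast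
    have "j \<noteq> i"
      using i j z(2) by metis
    with i j y show "y \<in> (\<Union>(i, j)\<in>(SIGMA i:J. J - {i}). {y \<in> X. p y i = p x i \<and> p y j = p (z i) j})"
      by blast
  qed
  then have "X = (\<Union>(i, j)\<in>(SIGMA i:J. J - {i}). {y \<in> X. p y i = p x i \<and> p y j = p (z i) j})"
    by (intro subset_antisym) auto
  then show ?thesis by (intro exI[of _ z])
qed

text \<open>
  The number of pieces in the cover is compared with a product of \<open>2 ^ (c - 1)\<close> factors that are at
  least \<open>2\<close>, one for each direction whose support is \<open>J\<close> without one coordinate, where \<open>c = card J\<close>.
\<close>

lemma mult_pred_le_double_exp: "c * (c - 1) \<le> (2::nat) ^ 2 ^ (c - 1)"
proof -
  have lin: "c \<le> 2 ^ (c - 1)" for c :: nat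
  proof (induction c)
    case (Suc c)
    then show ?case by (cases c) auto
  qed simp
  have "c * (c - 1) \<le> 2 ^ c"
  proof (induction c)
    case (Suc c)
    have "Suc c * (Suc c - 1) = c * (c - 1) + 2 * c"
      by (cases c) auto
    also have "2 * c \<le> 2 ^ c"
      using lin[of c] by (cases c) auto
    finally show ?case using Suc by simp
  qed simp
  also have "\<dots> \<le> 2 ^ 2 ^ (c - 1)"
    using lin by (intro power_increasing) auto
  finally show ?thesis .
qed

section \<open>The bound\<close>

text \<open>
  The statement is about points agreeing outside \<open>J\<close>, rather than points of a smaller space, so that
  fixing a coordinate only shrinks \<open>J\<close> and leaves directions, relations and chains unchanged.
\<close>

lemma card_le_lambda_star:
  fixes X :: "'a::linorder set" and p :: "'a \<Rightarrow> nat \<Rightarrow> real"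
  assumes l: "\<And>d. d \<in> directions n \<Longrightarrow> l d \<ge> 2"
    and "finite X" "J \<subseteq> {1..n}"
    and "\<And>a b i. a \<in> X \<Longrightarrow> b \<in> X \<Longrightarrow> i \<in> {1..n} - J \<Longrightarrow> p a i = p b i"
    and "\<And>d Y. d \<in> directions n \<Longrightarrow> Y \<subseteq> X \<Longrightarrow> monotone_on Y (<) (step_in n d) p \<Longrightarrow> card Y \<le> l d"
  shows "card X \<le> lambda_star n l (insert 1 (Suc ` J))"
  using assms(2-)
proof (induction "card J" arbitrary: J X rule: less_induct)
  case less
  note agree = less.prems(3) and chains = less.prems(4)
  have finJ: "finite J"
    using less.prems(2) finite_subset by blast
  define \<Lambda> where "\<Lambda> K = lambda_star n l (insert 1 (Suc ` K))" for K
  define M where "M K = (\<Prod>d\<in>supported_directions n K. l d)" for K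
  have step: "M K * \<Lambda> (K - {i}) \<le> \<Lambda> K" if "K \<subseteq> J" "i \<in> K" for K i
  proof -
    have "finite (insert 1 (Suc ` K))" "K \<subseteq> {1..n}"
      using that finJ less.prems(2) by (auto intro: finite_subset)
    moreover from this have "insert 1 (Suc ` K) - {Suc i} = insert 1 (Suc ` (K - {i}))"
      using that by auto
    ultimately show ?thesis
      using m_star_mult_lambda_star_le[of "insert 1 (Suc ` K)" "Suc i" n l] that
      unfolding \<Lambda>_def M_def by (simp add: m_star_insert_Suc_image[simplified])
  qed
  have IH: "card Y \<le> \<Lambda> K"
    if "K \<subset> J" "Y \<subseteq> X" "\<And>a b i. a \<in> Y \<Longrightarrow> b \<in> Y \<Longrightarrow> i \<in> J - K \<Longrightarrow> p a i = p b i" for K Y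
    unfolding \<Lambda>_def
  proof (rule less.hyps)
    show "card K < card J"
      using finJ that(1) by (rule psubset_card_mono)
    show "finite Y" "K \<subseteq> {1..n}"
      using that less.prems(1,2) by (auto intro: finite_subset)
    show "p a i = p b i" if "a \<in> Y" "b \<in> Y" "i \<in> {1..n} - K" for a b i
      using that \<open>\<And>a b i. a \<in> Y \<Longrightarrow> b \<in> Y \<Longrightarrow> i \<in> J - K \<Longrightarrow> p a i = p b i\<close>[of a b i]
        \<open>Y \<subseteq> X\<close> agree[of a b i] by blast
    show "card Z \<le> l d" if "d \<in> directions n" "Z \<subseteq> Y" "monotone_on Z (<) (step_in n d) p" for d Z
      using chains that \<open>Y \<subseteq> X\<close> by blast
  qed
  \<comment> \<open>For \<open>J = {}\<close> a piece without steps is a single index, since equal points form a step in the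
      zero direction; the bound \<open>1\<close> also matches \<open>lambda_star n l {} = 1\<close>.\<close>
  define B where "B = (if J = {} then 1 else Max ((\<lambda>i. \<Lambda> (J - {i})) ` J))"
  have B: "\<Lambda> (J - {i}) \<le> B" if "i \<in> J" for i
    using that finJ by (auto simp: B_def)
  have "card X \<le> M J * B"
    unfolding M_def
  proof (rule card_le_by_layers[where R = "step_in n" and p = p])
    show "finite X" by fact
    show "card Y \<le> l d" if "d \<in> supported_directions n J" "Y \<subseteq> X" "monotone_on Y (<) (step_in n d) p" for d Y
      using that chains by (auto simp: supported_directions_def)
    show "step_in n d p r" if "d \<in> supported_directions n J" "step_in n d p q" "step_in n d q r" for d p q r
      using step_in_trans[OF _ that(2,3)] that(1) by (simp add: supported_directions_def)
  next
    fix Z assume Z: "Z \<subseteq> X" and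
      no_step: "\<And>d a b. d \<in> supported_directions n J \<Longrightarrow> a \<in> Z \<Longrightarrow> b \<in> Z \<Longrightarrow> a < b \<Longrightarrow> \<not> step_in n d (p a) (p b)"
    have meet_less: "\<exists>i\<in>J. p a i = p b i" if "a \<in> Z" "b \<in> Z" "a < b" for a b
    proof (rule ccontr)
      assume "\<not> ?thesis"
      then have "{i \<in> {1..n}. p a i \<noteq> p b i} = J"
        using agree[of a b] that Z less.prems(2) by blast
      then show False
        using ex_step_in[of n "p a" "p b"] no_step that by metis
    qed
    show "card Z \<le> B"
    proof (cases "J = {}")
      case True
      then have "a = b" if "a \<in> Z" "b \<in> Z" for a b
        using meet_less[of a b] meet_less[of b a] that by (cases a b rule: linorder_cases) auto
      then show ?thesis
        using True by (simp add: B_def card_le_Suc0_iff_eq[OF finite_subset[OF Z less.prems(1)]])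
    next
      case False
      then have meet: "\<exists>i\<in>J. p a i = p b i" if "a \<in> Z" "b \<in> Z" for a b
        using meet_less[of a b] meet_less[of b a] that by (cases a b rule: linorder_cases) force+
      show ?thesis
      proof (cases "Z \<noteq> {} \<and> (\<forall>i\<in>J. \<exists>a\<in>Z. \<exists>b\<in>Z. p a i \<noteq> p b i)")
        case spread: True
        then obtain x where "x \<in> Z" by blast
        have "\<exists>a\<in>Z. \<exists>b\<in>Z. p a i \<noteq> p b i" if "i \<in> J" for i
          using spread that by blast
        from intersecting_family_cover[of Z J p x, OF meet this \<open>x \<in> Z\<close>] obtain z where
          z: "Z = (\<Union>(i, j)\<in>(SIGMA i:J. J - {i}). {y \<in> Z. p y i = p x i \<and> p y j = p (z i) j})"
          by blast
        \<comment> \<open>Each piece of the cover loses two coordinates, so \<open>B\<close> is at least \<open>M (J - {i})\<close> times its size.\<close>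
        define F where "F = (\<lambda>(i, j). {y \<in> Z. p y i = p x i \<and> p y j = p (z i) j})"
        have double: "2 ^ 2 ^ (card J - 1) * card (F ij) \<le> B" if ij_in: "ij \<in> (SIGMA i:J. J - {i})" for ij
        proof -
          obtain i j where ij: "ij = (i, j)" "i \<in> J" "j \<in> J" "i \<noteq> j"
            using ij_in by auto
          have "card (F ij) \<le> \<Lambda> (J - {i} - {j})"
            using ij Z by (intro IH) (auto simp: F_def)
          moreover have "2 ^ 2 ^ (card J - 1) \<le> M (J - {i})"
          proof -
            have "(2::nat) ^ 2 ^ (card J - 1) = (\<Prod>d\<in>supported_directions n (J - {i}). 2)"
              using ij finJ less.prems(2) by (subst prod_constant, subst card_supported_directions) auto
            also have "\<dots> \<le> M (J - {i})"
              unfolding M_def using l by (intro prod_mono) (auto simp: supported_directions_def)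
            finally show ?thesis .
          qed
          ultimately have "2 ^ 2 ^ (card J - 1) * card (F ij) \<le> M (J - {i}) * \<Lambda> (J - {i} - {j})"
            by (intro mult_mono) auto
          also have "\<dots> \<le> \<Lambda> (J - {i})"
            using ij by (intro step) auto
          also have "\<dots> \<le> B"
            using ij by (intro B)
          finally show ?thesis .
        qed
        define N where "N = card (SIGMA i:J. J - {i})"
        have "N = card J * (card J - 1)"
          unfolding N_def using finJ by (subst card_SigmaI) auto
        then have N: "N \<le> 2 ^ 2 ^ (card J - 1)"
          using mult_pred_le_double_exp[of "card J"] by (simp only:)
        have "Z = (\<Union>ij\<in>(SIGMA i:J. J - {i}). F ij)"
          unfolding F_def by (fact z)
        then have "card Z = card (\<Union>ij\<in>(SIGMA i:J. J - {i}). F ij)"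
          by (rule arg_cong)
        also have "\<dots> \<le> (\<Sum>ij\<in>(SIGMA i:J. J - {i}). card (F ij))"
          using finJ by (intro card_UN_le) auto
        finally have "2 ^ 2 ^ (card J - 1) * card Z \<le>
            (\<Sum>ij\<in>(SIGMA i:J. J - {i}). 2 ^ 2 ^ (card J - 1) * card (F ij))"
          unfolding sum_distrib_left[symmetric] by (rule mult_le_mono2)
        also have "\<dots> \<le> (\<Sum>ij\<in>(SIGMA i:J. J - {i}). B)"
          by (intro sum_mono double)
        also have "\<dots> = N * B"
          by (simp only: N_def sum_constant of_nat_id)
        also have "\<dots> \<le> 2 ^ 2 ^ (card J - 1) * B"
          using N by simp
        finally show ?thesis by simp
      next
        case False
        then consider "Z = {}" | i where "i \<in> J" "\<And>a b. a \<in> Z \<Longrightarrow> b \<in> Z \<Longrightarrow> p a i = p b i"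
          by blast
        then show ?thesis
        proof cases
          case 2
          have "card Z \<le> \<Lambda> (J - {i})"
          proof (rule IH[OF _ Z])
            show "J - {i} \<subset> J"
              using 2(1) by blast
            show "p a k = p b k" if "a \<in> Z" "b \<in> Z" "k \<in> J - (J - {i})" for a b k
              using that 2(2)[of a b] by auto
          qed
          with B[OF 2(1)] show ?thesis by simp
        qed simp
      qed
    qed
  qed simp
  also have "M J * B \<le> \<Lambda> J"
  proof (cases "J = {}")
    case True
    have "lambda_star n l {} = 1"
      by (simp add: lambda_star.simps)
    then show ?thesis
      using True m_star_mult_lambda_star_le[of "{1}" 1 n l] m_star_insert_Suc_image[of "{}" n l]
      by (simp add: B_def M_def \<Lambda>_def)
  next
    case False
    then have "B \<in> (\<lambda>i. \<Lambda> (J - {i})) ` J"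
      using finJ unfolding B_def by (simp only: if_False, intro Max_in) auto
    then show ?thesis
      using step[OF subset_refl] by auto
  qed
  finally show ?case by (simp add: \<Lambda>_def)
qed

section \<open>Sequences of points\<close>

lemma sorted_wrt_nths:
  assumes "monotone_on Y (<) R ((!) xs)" "Y \<subseteq> {..<length xs}"
  shows "sorted_wrt R (nths xs Y)" "length (nths xs Y) = card Y"
proof -
  have "nths xs Y = map ((!) xs) (filter (\<lambda>i. i \<in> Y) [0..<length xs])"
  proof -
    have "zip xs [0..<length xs] = map (\<lambda>i. (xs ! i, i)) [0..<length xs]"
      by (rule nth_equalityI) auto
    then show ?thesis
      by (simp add: nths_def filter_map o_def)
  qed
  moreover have "sorted_wrt (<) (filter (\<lambda>i. i \<in> Y) [0..<length xs])"
    by (intro sorted_wrt_filter) simp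
  ultimately show "sorted_wrt R (nths xs Y)"
    using assms(1) by (auto intro!: sorted_wrt_map_mono simp: monotone_on_def)
  show "length (nths xs Y) = card Y"
    using assms(2) by (auto simp: length_nths intro: arg_cong[where f = card])
qed

lemma ex_strictly_monotonic_subseq:
  fixes S :: "(nat \<Rightarrow> real) list"
  assumes l: "\<And>d. d \<in> directions n \<Longrightarrow> l d \<ge> 2" and "length S > lambda_star n l {1..n + 1}"
  shows "\<exists>d\<in>directions n. \<exists>T. subseq T S \<and> length T = l d + 1 \<and> strictly_monotonic_in n d T"
proof (rule ccontr)
  assume none: "\<not> ?thesis"
  \<comment> \<open>A chain of indices that is too long can be cut down to length exactly \<open>l d + 1\<close>.\<close>
  have "card Y \<le> l d" if "d \<in> directions n" "Y \<subseteq> {..<length S}"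
    "monotone_on Y (<) (step_in n d) ((!) S)" for d Y
  proof (rule ccontr)
    assume "\<not> card Y \<le> l d"
    then obtain Y' where Y': "Y' \<subseteq> Y" "card Y' = l d + 1"
      by (metis Suc_eq_plus1 not_less_eq_eq obtain_subset_with_card_n)
    then have mono: "monotone_on Y' (<) (step_in n d) ((!) S)" "Y' \<subseteq> {..<length S}"
      using that(2,3) by (auto simp: monotone_on_def)
    have "subseq (nths S Y') S" "length (nths S Y') = l d + 1"
      "strictly_monotonic_in n d (nths S Y')"
      using sorted_wrt_nths[OF mono] Y' that(1) by (auto simp: subseq_conv_nths strictly_monotonic_in_iff)
    with none that(1) show False by blast
  qed
  then have "card {..<length S} \<le> lambda_star n l (insert 1 (Suc ` {1..n}))"
    using l by (intro card_le_lambda_star[where p = "(!) S"]) auto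
  also have "insert 1 (Suc ` {1..n}) = {1..n + 1}"
    by (auto simp: image_Suc_atLeastAtMost)
  finally show False
    using assms(2) by simp
qed

theorem theorem7:
  fixes n :: nat and S :: "(nat \<Rightarrow> real) list"
  assumes "n \<ge> 1" and "set S \<subseteq> points n"
  shows "(\<forall>l :: (nat \<Rightarrow> int) \<Rightarrow> nat.
            (\<forall>d\<in>directions n. l d \<ge> 2) \<and> length S > lambda_star n l {1..n + 1} \<longrightarrow>
            (\<exists>d\<in>directions n. \<exists>T. subseq T S \<and> length T = l d + 1 \<and> strictly_monotonic_in n d T)) \<and>
         (\<forall>l :: nat. l \<ge> 1 \<and> length S > l ^ (2 ^ (n + 1) - 1) \<longrightarrow>
            (\<exists>T. subseq T S \<and> length T = l + 1 \<and> strictly_monotonic n T))"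
proof (intro conjI allI impI)
  fix l :: "(nat \<Rightarrow> int) \<Rightarrow> nat"
  assume "(\<forall>d\<in>directions n. l d \<ge> 2) \<and> length S > lambda_star n l {1..n + 1}"
  then show "\<exists>d\<in>directions n. \<exists>T. subseq T S \<and> length T = l d + 1 \<and> strictly_monotonic_in n d T"
    by (intro ex_strictly_monotonic_subseq) auto
next
  fix l :: nat
  assume l: "l \<ge> 1 \<and> length S > l ^ (2 ^ (n + 1) - 1)"
  show "\<exists>T. subseq T S \<and> length T = l + 1 \<and> strictly_monotonic n T"
  proof (cases "l = 1")
    case True
    then obtain p q S' where S: "S = p # q # S'"
      using l by (cases S; cases "tl S") auto
    obtain d where "d \<in> supported_directions n {i \<in> {1..n}. p i \<noteq> q i}" "step_in n d p q"
      by (rule ex_step_in)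
    then have "strictly_monotonic n [p, q]"
      by (auto simp: strictly_monotonic_def supported_directions_def strictly_monotonic_in_iff)
    then show ?thesis
      using True S by (intro exI[of _ "[p, q]"]) auto
  next
    case False
    have "lambda_star n (\<lambda>_. l) {1..n + 1} < length S"
      using l lambda_star_const_le[of l "{1..n + 1}" n] by simp
    then show ?thesis
      using ex_strictly_monotonic_subseq[of n "\<lambda>_. l" S] l False
      by (auto simp: strictly_monotonic_def)
  qed
qed

end
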